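(* Let $m\ge 1$ and let $Y\in\mathbb{R}^{m\times m}$ be a matrix of full rank. For $m\times m$ real symmetric positive definite matrices $\Sigma_{\mathrm r},\Sigma_{\mathrm c}$ put $$l(\Sigma_{\mathrm r},\Sigma_{\mathrm c};Y)=\mathrm{tr}\left[\Sigma_{\mathrm r}^{-1}Y\Sigma_{\mathrm c}^{-1}Y^{t}\right]-\log\left|\Sigma_{\mathrm c}^{-1}\otimes\Sigma_{\mathrm r}^{-1}\right|.$$ Then for all $(\Sigma_{\mathrm r},\Sigma_{\mathrm c})\in\mathcal{S}_+^m\times\mathcal{S}_+^m$, $$l(\Sigma_{\mathrm r},\Sigma_{\mathrm c};Y)\ \ge\ m^2+m\log\left|YY^t/m\right|,$$ with equality if $\Sigma_{\mathrm r}=Y\Sigma_{\mathrm c}^{-1}Y^t/m$, or equivalently, if $\Sigma_{\mathrm c}=Y^t\Sigma_{\mathrm r}^{-1}Y/m$.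
   Context: $\mathcal{S}_+^m$ is the set of $m\times m$ real symmetric positive definite matrices. $|A|$ denotes the determinant of $A$, $\mathrm{tr}$ the trace, $\otimes$ the Kronecker product, and $A^t$ the transpose. The function $l$ is minus two times the log-likelihood, minus $m^2\log 2\pi$, of the mean-zero matrix normal distribution $N_{m\times m}(0,\Sigma_{\mathrm r},\Sigma_{\mathrm c})$, i.e. of $\mathrm{vec}(Y)\sim N_{m^2}(0,\Sigma_{\mathrm c}\otimes\Sigma_{\mathrm r})$. *)

theory Defs
  imports "HOL-Analysis.Analysis"
begin

definition spd_matrices :: "(real ^ 'm ^ 'm) set"
  where "spd_matrices = {A. transpose A = A \<and> (\<forall>x. x \<noteq> 0 \<longrightarrow> x \<bullet> (A *v x) > 0)}"

(* Rows and columns are indexed by pairs (block index, index inside the block), so block (i, j)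
   is A $ i $ j times B. No order on the pairs is needed: applying the same permutation to the
   rows and to the columns does not change the determinant. *)
definition kronecker :: "real ^ 'm ^ 'm \<Rightarrow> real ^ 'n ^ 'n \<Rightarrow> real ^ ('m \<times> 'n) ^ ('m \<times> 'n)"
  where "kronecker A B = (\<chi> p q. A $ fst p $ fst q * B $ snd p $ snd q)"

(* Minus twice the log-likelihood, without the additive constant CARD('m)^2 * ln (2 * pi), of
   the covariances R (of rows) and C (of columns) for one observation Y of the mean-zero matrix
   normal distribution, whose column-stacked vectorisation has covariance kronecker C R. *)
definition matnorm_loss :: "real ^ 'm ^ 'm \<Rightarrow> real ^ 'm ^ 'm \<Rightarrow> real ^ 'm ^ 'm \<Rightarrow> real"
  where "matnorm_loss R C Y =
    trace (matrix_inv R ** Y ** matrix_inv C ** transpose Y)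
      - ln (det (kronecker (matrix_inv C) (matrix_inv R)))"

end

theory Submission
  imports Defs
begin

text \<open>Put \<open>S = Y C\<^sup>-\<^sup>1 Y\<^sup>t / m\<close> and let \<open>W W\<^sup>t = R\<^sup>-\<^sup>1\<close>. Up to the term \<open>ln (det (Y Y\<^sup>t / m))\<close>, the loss is \<open>m\<close> times
  \<open>tr T - ln (det T)\<close> for the positive definite matrix \<open>T = W\<^sup>t S W\<close>, because the determinant of the
  Kronecker product is \<open>(det C det R)\<^sup>-\<^sup>m\<close>. Summing \<open>x - ln x \<ge> 1\<close> over the eigenvalues of \<open>T\<close> gives
  the bound; it is attained when \<open>S = R\<close>, where \<open>T\<close> is the identity.\<close>

subsection \<open>The spectral theorem for symmetric matrices\<close>

text \<open>By compactness the quadratic form \<open>x \<bullet> f x\<close> attains its maximum on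
  the unit sphere of \<open>S\<close>, and a maximizer is an eigenvector. Working inside an
  invariant subspace allows the later use on an orthogonal complement.\<close>

lemma self_adjoint_eigenvector:
  fixes f :: "'a::euclidean_space \<Rightarrow> 'a"
  assumes "linear f" and sa: "\<And>x y. f x \<bullet> y = x \<bullet> f y"
    and S: "subspace S" "f ` S \<subseteq> S" "S \<noteq> {0}"
  obtains x l where "x \<in> S" "norm x = 1" "f x = l *\<^sub>R x"
proof -
  interpret f: linear f by fact
  let ?K = "S \<inter> sphere 0 1"
  obtain v where v: "v \<in> S" "v \<noteq> 0" using S subspace_0 by blast
  then have "v /\<^sub>R norm v \<in> ?K" using S(1) by (simp add: subspace_scale)
  then have ne: "?K \<noteq> {}" by blast
  have "compact ?K" using closed_subspace[OF S(1)] by (simp add: closed_Int_compact)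
  moreover have "continuous_on ?K (\<lambda>x. x \<bullet> f x)"
    using \<open>linear f\<close> by (intro continuous_intros linear_continuous_on) (simp add: linear_conv_bounded_linear)
  ultimately obtain x where x: "x \<in> ?K" and max: "\<And>y. y \<in> ?K \<Longrightarrow> y \<bullet> f y \<le> x \<bullet> f x"
    using continuous_attains_sup[OF _ ne] by blast
  define l where "l = x \<bullet> f x"
  have q: "y \<bullet> f y \<le> l * (y \<bullet> y)" if "y \<in> S" for y
  proof (cases "y = 0")
    case False
    then have "y /\<^sub>R norm y \<in> ?K" using that S(1) by (simp add: subspace_scale)
    from max[OF this] have "(y \<bullet> f y) / (norm y)\<^sup>2 \<le> l"
      by (simp add: f.scaleR l_def power2_eq_square field_simps)
    with False show ?thesis by (simp add: field_simps dot_square_norm)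
  qed simp
  \<comment> \<open>The residual \<open>w\<close> is the gradient direction of the Rayleigh quotient at its maximum \<open>x\<close>, so it vanishes.\<close>
  define w where "w = f x - l *\<^sub>R x"
  have xx: "x \<bullet> x = 1" using x by (simp add: dot_square_norm)
  have wS: "w \<in> S" using x S unfolding w_def by (auto intro!: subspace_diff subspace_scale)
  define p where "p = w \<bullet> w"
  define c where "c = w \<bullet> f w - l * p"
  have wx: "w \<bullet> f x = p + l * (w \<bullet> x)" unfolding p_def by (simp add: w_def algebra_simps)
  \<comment> \<open>Expand \<open>q\<close> at \<open>x + t *\<^sub>R w\<close>: the constant terms
    and those with \<open>w \<bullet> x\<close> cancel, leaving \<open>2 * t * p\<close> at first
    order.\<close>
  have var: "2 * t * p + t\<^sup>2 * c \<le> 0" for t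
  proof -
    have "x + t *\<^sub>R w \<in> S" using x wS S(1) by (simp add: subspace_add subspace_scale)
    from q[OF this] have "l + t * (x \<bullet> f w) + t * (w \<bullet> f x) + t\<^sup>2 * (w \<bullet> f w)
        \<le> l * (1 + 2 * t * (w \<bullet> x) + t\<^sup>2 * p)"
      by (simp add: f.add f.scaleR inner_add_left inner_add_right xx l_def[symmetric] p_def
          inner_commute[of x w] power2_eq_square algebra_simps)
    moreover have "x \<bullet> f w = w \<bullet> f x" using sa[of x w] by (simp add: inner_commute)
    ultimately show ?thesis unfolding wx c_def by (simp add: algebra_simps)
  qed
  have "p = 0"
  proof (rule ccontr)
    assume "p \<noteq> 0"
    then have p: "p > 0" by (simp add: p_def)
    \<comment> \<open>Small enough that the quadratic term is at most \<open>t * p\<close> in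
      absolute value, half of the linear term \<open>2 * t * p\<close>.\<close>
    define t where "t = p / (\<bar>c\<bar> + 1)"
    have t: "t > 0" using p by (simp add: t_def)
    have "t * \<bar>c\<bar> \<le> p" using p by (simp add: t_def field_simps)
    then have "- (t * c) \<le> p" using t by (smt (verit) mult_minus_right mult_left_mono)
    then have "t * (2 * p + t * c) > 0" using t p by (intro mult_pos_pos) auto
    with var[of t] show False by (simp add: algebra_simps power2_eq_square)
  qed
  then have "f x = l *\<^sub>R x" by (simp add: p_def w_def)
  with x that show ?thesis by auto
qed

text \<open>Take an orthonormal set of eigenvectors of greatest cardinality. Self-adjointness makes
  its orthogonal complement invariant, so a nonzero complement would contain a further unit
  eigenvector.\<close>

lemma self_adjoint_orthonormal_eigenbasis:
  fixes f :: "'a::euclidean_space \<Rightarrow> 'a"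
  assumes "linear f" and sa: "\<And>x y. f x \<bullet> y = x \<bullet> f y"
  obtains B where "pairwise orthogonal B" "finite B" "card B = DIM('a)"
    "\<And>x. x \<in> B \<Longrightarrow> norm x = 1 \<and> (\<exists>l. f x = l *\<^sub>R x)"
proof -
  define P where "P B \<longleftrightarrow> pairwise orthogonal B \<and> (\<forall>x\<in>B. norm x = 1 \<and> (\<exists>l. f x = l *\<^sub>R x))" for B
  have ind: "independent B" if "P B" for B
    using that by (intro pairwise_orthogonal_independent) (auto simp: P_def)
  have "\<forall>B. P B \<longrightarrow> card B < Suc DIM('a)"
    using ind independent_card_le by (metis less_Suc_eq_le)
  moreover have "P {}" by (simp add: P_def pairwise_def)
  ultimately obtain B where B: "P B" and max: "\<And>B'. P B' \<Longrightarrow> card B' \<le> card B"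
    using ex_has_greatest_nat[of P "{}" card] by metis
  have fin: "finite B" using ind[OF B] independent_bound by blast
  have "card B = DIM('a)"
  proof (rule ccontr)
    assume "card B \<noteq> DIM('a)"
    then have "dim B < DIM('a)"
      using independent_card_le[OF ind[OF B]] dim_eq_card_independent[OF ind[OF B]] by simp
    then obtain v where v: "v \<noteq> 0" "\<And>y. y \<in> span B \<Longrightarrow> orthogonal v y"
      using orthogonal_to_subspace_exists by blast
    define S where "S = {x. \<forall>b\<in>B. orthogonal b x}"
    have "subspace S" by (auto simp: S_def subspace_def orthogonal_clauses)
    moreover have "f ` S \<subseteq> S"
    proof clarify
      fix x assume x: "x \<in> S"
      show "f x \<in> S" unfolding S_def
      proof clarify
        fix b assume b: "b \<in> B"
        then obtain l where "f b = l *\<^sub>R b" using B by (auto simp: P_def)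
        then show "orthogonal b (f x)"
          using x b sa[of b x] by (auto simp: S_def orthogonal_def)
      qed
    qed
    moreover have "S \<noteq> {0}" using v span_base[of _ B] by (force simp: S_def orthogonal_commute)
    ultimately obtain x l where x: "x \<in> S" "norm x = 1" "f x = l *\<^sub>R x"
      using self_adjoint_eigenvector[OF assms] by blast
    have "x \<notin> B" using x by (auto simp: S_def orthogonal_def)
    have "P (insert x B)" using B x by (auto simp: P_def S_def pairwise_insert orthogonal_commute)
    from max[OF this] show False using fin \<open>x \<notin> B\<close> by simp
  qed
  with B fin that show ?thesis by (auto simp: P_def)
qed

section \<open>Diagonal matrices and orthogonal diagonalization\<close>

definition diag_matrix :: "('n \<Rightarrow> real) \<Rightarrow> real ^ 'n ^ 'n"
  where "diag_matrix d = (\<chi> i j. if i = j then d i else 0)"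

lemma det_diag_matrix: "det (diag_matrix d) = prod d UNIV"
  by (simp add: det_diagonal diag_matrix_def)

lemma trace_diag_matrix: "trace (diag_matrix d) = sum d UNIV"
  by (simp add: trace_def diag_matrix_def)

lemma transpose_diag_matrix: "transpose (diag_matrix d) = diag_matrix d"
  by (auto simp add: transpose_def diag_matrix_def vec_eq_iff)

lemma diag_matrix_mult: "diag_matrix d ** diag_matrix e = diag_matrix (\<lambda>i. d i * e i)"
  by (auto simp: matrix_matrix_mult_def diag_matrix_def vec_eq_iff if_distrib[of "\<lambda>x. x * _"] cong: if_cong)

lemma symmetric_matrix_self_adjoint:
  fixes A :: "real ^ 'n ^ 'n"
  assumes "transpose A = A"
  shows "(A *v x) \<bullet> y = x \<bullet> (A *v y)"
  by (metis assms dot_lmul_matrix vector_transpose_matrix)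

text \<open>The columns of \<open>Q\<close> are an orthonormal eigenbasis, so
  \<open>A ** Q = Q ** diag_matrix d\<close>; then multiply by \<open>transpose Q\<close> on the
  right.\<close>

lemma symmetric_matrix_diagonalization:
  fixes A :: "real ^ 'n ^ 'n"
  assumes "transpose A = A"
  obtains Q d where "orthogonal_matrix Q" "A = Q ** diag_matrix d ** transpose Q"
proof -
  obtain B where B: "pairwise orthogonal B" "finite B" "card B = CARD('n)"
    and eig: "\<And>x. x \<in> B \<Longrightarrow> norm x = 1 \<and> (\<exists>l. A *v x = l *\<^sub>R x)"
    using self_adjoint_orthonormal_eigenbasis[OF matrix_vector_mul_linear
        symmetric_matrix_self_adjoint[OF assms]] by (metis DIM_cart DIM_real mult.right_neutral)
  \<comment> \<open>The basis is an unordered set; a bijection with the index type turns it into a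
    family of columns.\<close>
  obtain b where b: "bij_betw b (UNIV :: 'n set) B"
    using B by (metis finite_same_card_bij finite_class.finite_UNIV)
  have bB: "b i \<in> B" for i using b by (auto simp: bij_betw_def)
  have "inj b" using b by (auto simp: bij_betw_def)
  obtain d where d: "\<And>i. A *v b i = d i *\<^sub>R b i" using eig[OF bB] by metis
  define Q :: "real ^ 'n ^ 'n" where "Q = (\<chi> i j. b j $ i)"
  have col: "column j Q = b j" for j by (simp add: Q_def column_def vec_eq_iff)
  have Q: "orthogonal_matrix Q"
    using B(1) bB eig \<open>inj b\<close>
    by (auto simp: orthogonal_matrix_orthonormal_columns col pairwise_def inj_eq)
  have "A ** Q = Q ** diag_matrix d"
  proof -
    have "(A ** Q) $ i $ j = (Q ** diag_matrix d) $ i $ j" for i j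
    proof -
      have "(A ** Q) $ i $ j = (A *v b j) $ i"
        by (simp add: matrix_matrix_mult_def matrix_vector_mult_def Q_def)
      also have "\<dots> = (Q ** diag_matrix d) $ i $ j"
        by (simp add: d matrix_matrix_mult_def diag_matrix_def Q_def if_distrib[of "\<lambda>x. _ * x"] cong: if_cong)
      finally show ?thesis .
    qed
    then show ?thesis by (simp add: vec_eq_iff)
  qed
  then have "A ** (Q ** transpose Q) = Q ** diag_matrix d ** transpose Q"
    by (simp add: matrix_mul_assoc)
  with Q that show ?thesis by (simp add: orthogonal_matrix_def)
qed

lemma det_orthogonal_conjugate:
  fixes Q :: "real ^ 'n ^ 'n"
  assumes "orthogonal_matrix Q"
  shows "det (Q ** D ** transpose Q) = det D"
  using det_orthogonal_matrix[OF assms] by (auto simp: det_mul)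

lemma trace_orthogonal_conjugate:
  fixes Q :: "real ^ 'n ^ 'n"
  assumes "orthogonal_matrix Q"
  shows "trace (Q ** D ** transpose Q) = trace D"
  using assms by (metis matrix_mul_assoc matrix_mul_lid orthogonal_matrix_def trace_mul_sym)

subsection \<open>The determinant of a Kronecker product\<close>

lemma kronecker_mult:
  fixes A A' :: "real ^ 'm ^ 'm" and B B' :: "real ^ 'n ^ 'n"
  shows "kronecker A B ** kronecker A' B' = kronecker (A ** A') (B ** B')"
  by (auto simp: vec_eq_iff kronecker_def matrix_matrix_mult_def sum_product sum.cartesian_product
      case_prod_unfold algebra_simps)

lemma transpose_kronecker: "transpose (kronecker A B) = kronecker (transpose A) (transpose B)"
  by (simp add: vec_eq_iff kronecker_def transpose_def)

lemma kronecker_mat_1: "kronecker (mat 1) (mat 1) = mat 1"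
  by (auto simp: vec_eq_iff kronecker_def mat_def)

lemma kronecker_diag_matrix:
  "kronecker (diag_matrix d) (diag_matrix e) = diag_matrix (\<lambda>p. d (fst p) * e (snd p))"
  by (auto simp: vec_eq_iff kronecker_def diag_matrix_def)

text \<open>Diagonalizing both factors makes the Kronecker product orthogonally similar to a
  diagonal matrix whose entries are all products of an eigenvalue of \<open>A\<close> with one of
  \<open>B\<close>.\<close>

lemma det_kronecker:
  fixes A :: "real ^ 'm ^ 'm" and B :: "real ^ 'n ^ 'n"
  assumes "transpose A = A" and "transpose B = B"
  shows "det (kronecker A B) = det A ^ CARD('n) * det B ^ CARD('m)"
proof -
  obtain Q d where Q: "orthogonal_matrix Q" and A: "A = Q ** diag_matrix d ** transpose Q"
    by (rule symmetric_matrix_diagonalization[OF assms(1)])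
  obtain P e where P: "orthogonal_matrix P" and B: "B = P ** diag_matrix e ** transpose P"
    by (rule symmetric_matrix_diagonalization[OF assms(2)])
  have "orthogonal_matrix (kronecker Q P)"
    using Q P by (simp add: orthogonal_matrix_def transpose_kronecker kronecker_mult kronecker_mat_1)
  moreover have "kronecker A B = kronecker Q P ** kronecker (diag_matrix d) (diag_matrix e) ** transpose (kronecker Q P)"
    by (simp add: A B kronecker_mult transpose_kronecker)
  ultimately have "det (kronecker A B) = (\<Prod>p\<in>UNIV. d (fst p) * e (snd p))"
    by (simp add: det_orthogonal_conjugate kronecker_diag_matrix det_diag_matrix)
  also have "\<dots> = (\<Prod>i\<in>UNIV. \<Prod>j\<in>UNIV. d i * e j)"
    by (simp add: prod.cartesian_product case_prod_unfold)
  also have "\<dots> = prod d UNIV ^ CARD('n) * prod e UNIV ^ CARD('m)"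
    by (simp add: prod.distrib prod_power_distrib)
  finally show ?thesis
    by (simp add: A B det_orthogonal_conjugate Q P det_diag_matrix)
qed

subsection \<open>Positive definite matrices\<close>

lemma spd_matrices_diagonalization:
  fixes A :: "real ^ 'n ^ 'n"
  assumes "A \<in> spd_matrices"
  obtains Q d where "orthogonal_matrix Q" "A = Q ** diag_matrix d ** transpose Q" "\<And>i. d i > 0"
proof -
  have A: "transpose A = A" and pos: "\<And>x. x \<noteq> 0 \<Longrightarrow> x \<bullet> (A *v x) > 0"
    using assms by (auto simp: spd_matrices_def)
  obtain Q d where Q: "orthogonal_matrix Q" and AQ: "A = Q ** diag_matrix d ** transpose Q"
    by (rule symmetric_matrix_diagonalization[OF A])
  have "d i > 0" for i
  proof -
    \<comment> \<open>This is column \<open>i\<close> of \<open>Q\<close>; the quadratic form of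
      \<open>A\<close> takes the value \<open>d i\<close> there.\<close>
    let ?x = "Q *v axis i 1"
    have QQ: "transpose Q *v (Q *v y) = y" for y
      using Q by (simp add: matrix_vector_mul_assoc orthogonal_matrix_def)
    have "?x \<noteq> 0" using QQ[of "axis i 1"] by (metis axis_eq_0_iff matrix_vector_mult_0_right zero_neq_one)
    from pos[OF this] have "0 < axis i 1 \<bullet> (transpose Q *v (A *v ?x))"
      by (metis dot_lmul_matrix vector_transpose_matrix transpose_transpose)
    also have "transpose Q *v (A *v ?x) = diag_matrix d *v axis i 1"
      by (simp only: AQ QQ flip: matrix_vector_mul_assoc)
    also have "axis i 1 \<bullet> \<dots> = d i"
      by (simp add: inner_axis' matrix_vector_mult_basis column_def diag_matrix_def)
    finally show ?thesis .
  qed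
  with Q AQ that show ?thesis by blast
qed

lemma det_spd_matrices_pos: "A \<in> spd_matrices \<Longrightarrow> det A > 0"
  by (elim spd_matrices_diagonalization) (simp add: det_orthogonal_conjugate det_diag_matrix prod_pos)

lemma invertible_spd_matrices: "A \<in> spd_matrices \<Longrightarrow> invertible A"
  using det_spd_matrices_pos[of A] by (simp add: invertible_det_nz)

text \<open>The new quadratic form at \<open>x\<close> is that of \<open>A\<close> at
  \<open>W *v x\<close>, which is nonzero for nonzero \<open>x\<close>.\<close>

lemma spd_matrices_congruence:
  fixes A W :: "real ^ 'n ^ 'n"
  assumes "A \<in> spd_matrices" and "invertible W"
  shows "transpose W ** A ** W \<in> spd_matrices"
proof -
  have "x \<bullet> ((transpose W ** A ** W) *v x) > 0" if "x \<noteq> 0" for x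
  proof -
    have "W *v x \<noteq> 0"
      using inj_matrix_vector_mult[OF assms(2)] that by (metis injD matrix_vector_mult_0_right)
    then have "(W *v x) \<bullet> (A *v (W *v x)) > 0" using assms(1) by (simp add: spd_matrices_def)
    then show ?thesis
      by (metis dot_lmul_matrix vector_transpose_matrix matrix_vector_mul_assoc)
  qed
  then show ?thesis
    using assms(1) by (simp add: spd_matrices_def matrix_transpose_mul matrix_mul_assoc)
qed

section \<open>Inverses and square-root factors\<close>

lemma matrix_inv_mult:
  assumes "invertible (A :: real ^ 'n ^ 'n)"
  shows "A ** matrix_inv A = mat 1" "matrix_inv A ** A = mat 1"
  using assms unfolding invertible_def matrix_inv_def by (metis (mono_tags, lifting) someI_ex)+

lemma matrix_inv_unique:
  fixes A B :: "real ^ 'n ^ 'n"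
  assumes "A ** B = mat 1"
  shows "matrix_inv A = B"
  by (metis assms invertible_def matrix_inv_mult(2) matrix_left_right_inverse matrix_mul_assoc matrix_mul_lid matrix_mul_rid)

text \<open>The inverse is symmetric, hence equal to the congruence of \<open>A\<close> by
  \<open>matrix_inv A\<close>.\<close>

lemma matrix_inv_spd_matrices:
  assumes "A \<in> spd_matrices"
  shows "matrix_inv A \<in> spd_matrices"
proof -
  note inv = matrix_inv_mult[OF invertible_spd_matrices[OF assms]]
  have A: "transpose A = A" using assms by (simp add: spd_matrices_def)
  have t: "transpose (matrix_inv A) = matrix_inv A"
    by (metis A inv(2) matrix_inv_unique matrix_transpose_mul transpose_mat)
  have "invertible (matrix_inv A)" using inv by (auto simp: invertible_def)
  from spd_matrices_congruence[OF assms this] show ?thesis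
    by (simp add: t inv)
qed

lemma det_matrix_inv:
  assumes "invertible (A :: real ^ 'n ^ 'n)"
  shows "det (matrix_inv A) = inverse (det A)"
  by (metis assms det_I det_mul inverse_unique matrix_inv_mult(1))

text \<open>Scale the eigenvector columns by the square roots of the eigenvalues. The factor serves
  to replace a product of two positive definite matrices by a symmetric one with the same
  trace.\<close>

lemma spd_matrices_factorization:
  fixes A :: "real ^ 'n ^ 'n"
  assumes "A \<in> spd_matrices"
  obtains W :: "real ^ 'n ^ 'n" where "invertible W" "A = W ** transpose W"
proof -
  obtain Q d where Q: "orthogonal_matrix Q" "A = Q ** diag_matrix d ** transpose Q" and d: "\<And>i. d i > 0"
    using spd_matrices_diagonalization[OF assms] by blast
  define W where "W = Q ** diag_matrix (\<lambda>i. sqrt (d i))"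
  have "W ** transpose W = Q ** (diag_matrix (\<lambda>i. sqrt (d i)) ** diag_matrix (\<lambda>i. sqrt (d i))) ** transpose Q"
    by (simp add: W_def matrix_transpose_mul transpose_diag_matrix matrix_mul_assoc)
  also have "\<dots> = A" using d by (simp add: Q diag_matrix_mult less_imp_le)
  finally have A: "A = W ** transpose W" ..
  have "det W \<noteq> 0" using det_spd_matrices_pos[OF assms] by (auto simp: A det_mul)
  then have "invertible W" by (simp add: invertible_det_nz)
  from that[OF this A] show ?thesis .
qed

text \<open>Sum \<open>ln x \<le> x - 1\<close> over the eigenvalues.\<close>

lemma trace_spd_matrices_ge:
  fixes A :: "real ^ 'n ^ 'n"
  assumes "A \<in> spd_matrices"
  shows "trace A \<ge> real CARD('n) + ln (det A)"
proof -
  obtain Q d where Q: "orthogonal_matrix Q" "A = Q ** diag_matrix d ** transpose Q" and d: "\<And>i. d i > 0"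
    using spd_matrices_diagonalization[OF assms] by blast
  have "ln (det A) = (\<Sum>i\<in>UNIV. ln (d i))"
    unfolding Q(2) det_orthogonal_conjugate[OF Q(1)] det_diag_matrix
    by (rule ln_prod) (simp_all add: order_less_imp_not_eq2[OF d])
  also have "\<dots> \<le> (\<Sum>i\<in>UNIV. d i - 1)"
    using d by (intro sum_mono ln_le_minus_one) auto
  also have "\<dots> = trace A - real CARD('n)"
    by (simp add: Q trace_orthogonal_conjugate trace_diag_matrix sum_subtractf)
  finally show ?thesis by simp
qed

text \<open>\<open>A ** B\<close> may fail to be symmetric. Moving \<open>W\<close> cyclically under
  the trace gives a congruence of \<open>B\<close>, which is positive definite and has determinant
  \<open>det A * det B\<close>.\<close>

lemma trace_mult_spd_matrices_ge:
  fixes A B :: "real ^ 'n ^ 'n"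
  assumes "A \<in> spd_matrices" and "B \<in> spd_matrices"
  shows "trace (A ** B) \<ge> real CARD('n) + ln (det A) + ln (det B)"
proof -
  obtain W :: "real ^ 'n ^ 'n" where W: "invertible W" "A = W ** transpose W"
    by (rule spd_matrices_factorization[OF assms(1)])
  let ?T = "transpose W ** B ** W"
  have "trace (A ** B) = trace ?T"
    using trace_mul_sym[of W "transpose W ** B"] by (simp only: W(2) matrix_mul_assoc)
  moreover have "det ?T = det A * det B"
    unfolding W(2) det_mul det_transpose by (rule mult.commute[THEN trans]) (simp only: mult.assoc)
  then have "ln (det ?T) = ln (det A) + ln (det B)"
    using assms by (simp only: ln_mult_pos det_spd_matrices_pos)
  moreover have "trace ?T \<ge> real CARD('n) + ln (det ?T)"
    by (rule trace_spd_matrices_ge[OF spd_matrices_congruence[OF assms(2) W(1)]])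
  ultimately show ?thesis by linarith
qed

subsection \<open>The bound\<close>

lemma det_scaleR: "det (c *\<^sub>R A) = c ^ CARD('n) * det A" for A :: "real ^ 'n ^ 'n"
  using det_rows_mul[of "\<lambda>_. c" "\<lambda>i. A $ i"]
  by (simp add: scalar_mult_eq_scaleR scaleR_vec_def)

lemma trace_scaleR: "trace (c *\<^sub>R A) = c * trace A" for A :: "real ^ 'n ^ 'n"
  by (simp add: trace_def sum_distrib_left)

lemma scaleR_matrix_mult:
  fixes A :: "real ^ 'n ^ 'm" and B :: "real ^ 'k ^ 'n"
  shows "(c *\<^sub>R A) ** B = c *\<^sub>R (A ** B)" "A ** (c *\<^sub>R B) = c *\<^sub>R (A ** B)"
  by (simp_all add: matrix_matrix_mult_def vec_eq_iff sum_distrib_left mult_ac)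

text \<open>\<open>C\<close> is absorbed into \<open>S\<close>: since \<open>det S\<close> is
  \<open>det (matrix_inv C)\<close> times a constant depending only on \<open>Y\<close>, the loss
  becomes a function of \<open>matrix_inv R\<close> and \<open>S\<close> to which the trace
  inequality applies.\<close>

lemma matnorm_loss_eq:
  fixes Y R C :: "real ^ 'm ^ 'm"
  assumes "invertible Y" and "R \<in> spd_matrices" and "C \<in> spd_matrices"
  defines "S \<equiv> (Y ** matrix_inv C ** transpose Y) /\<^sub>R real CARD('m)"
  shows "S \<in> spd_matrices"
    and "matnorm_loss R C Y = real CARD('m) *
      (trace (matrix_inv R ** S) - ln (det (matrix_inv R)) - ln (det S)
        + ln (det ((Y ** transpose Y) /\<^sub>R real CARD('m))))"
proof -
  let ?m = "real CARD('m)"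
  have m: "?m > 0" by simp
  note Ci = matrix_inv_spd_matrices[OF assms(3)] and Ri = matrix_inv_spd_matrices[OF assms(2)]
  \<comment> \<open>Congruence of \<open>matrix_inv C\<close> by \<open>transpose Y\<close> gives
    the unscaled \<open>S\<close>.\<close>
  have "invertible (transpose Y)" using assms(1) by (simp add: invertible_det_nz)
  from spd_matrices_congruence[OF Ci this]
  show S: "S \<in> spd_matrices"
    using m by (simp add: S_def spd_matrices_def transpose_scalar scaleR_matrix_vector_assoc[symmetric])
  have pos: "det (matrix_inv R) > 0" "det (matrix_inv C) > 0" "det S > 0"
    using Ri Ci S by (auto intro: det_spd_matrices_pos)
  have Y: "det Y \<noteq> 0" using assms(1) by (simp add: invertible_det_nz)
  define D where "D = det ((Y ** transpose Y) /\<^sub>R ?m)"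
  have dS: "det S = D * det (matrix_inv C)"
    by (simp add: D_def S_def det_scaleR det_mul)
  with pos have "D > 0" by (metis zero_less_mult_pos2)
  have lS: "ln (det S) = ln D + ln (det (matrix_inv C))"
    unfolding dS using \<open>D > 0\<close> pos(2) by (simp add: ln_mult_pos)
  have "trace (matrix_inv R ** Y ** matrix_inv C ** transpose Y) = ?m * trace (matrix_inv R ** S)"
    by (simp add: S_def scaleR_matrix_mult trace_scaleR matrix_mul_assoc)
  moreover have "ln (det (kronecker (matrix_inv C) (matrix_inv R)))
      = ?m * (ln (det (matrix_inv C)) + ln (det (matrix_inv R)))"
    using Ri Ci pos
    by (simp add: det_kronecker spd_matrices_def ln_mult_pos ln_realpow algebra_simps)
  ultimately show "matnorm_loss R C Y = ?m *
      (trace (matrix_inv R ** S) - ln (det (matrix_inv R)) - ln (det S) + ln (det ((Y ** transpose Y) /\<^sub>R ?m)))"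
    unfolding matnorm_loss_def D_def[symmetric] lS by (simp add: algebra_simps)
qed

text \<open>Inverting the equation for \<open>R\<close> factor by factor gives
  \<open>matrix_inv R\<close>, and multiplying by \<open>transpose Y\<close> and \<open>Y\<close>
  isolates \<open>C\<close>. With general invertible matrices the lemma also yields the converse, by
  exchanging \<open>R\<close> with \<open>C\<close> and \<open>Y\<close> with
  \<open>transpose Y\<close>.\<close>

lemma flip_flop_fixed_point:
  fixes Y R C :: "real ^ 'm ^ 'm"
  assumes "invertible Y" "invertible R" "invertible C" "c \<noteq> 0"
    and R: "R = c *\<^sub>R (Y ** matrix_inv C ** transpose Y)"
  shows "C = c *\<^sub>R (transpose Y ** matrix_inv R ** Y)"
proof -
  note Y = matrix_inv_mult[OF assms(1)]
  have Yt: "transpose Y ** transpose (matrix_inv Y) = mat 1"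
    by (simp add: Y flip: matrix_transpose_mul)
  let ?I = "(1 / c) *\<^sub>R (transpose (matrix_inv Y) ** C ** matrix_inv Y)"
  have "R ** ?I = Y ** matrix_inv C ** (transpose Y ** transpose (matrix_inv Y)) ** C ** matrix_inv Y"
    using assms(4) by (simp add: R scaleR_matrix_mult matrix_mul_assoc)
  also have "\<dots> = Y ** (matrix_inv C ** C) ** matrix_inv Y"
    by (simp add: Yt matrix_mul_assoc)
  also have "\<dots> = mat 1" by (simp add: Y matrix_inv_mult[OF assms(3)])
  finally have "matrix_inv R = ?I" by (rule matrix_inv_unique)
  then have "c *\<^sub>R (transpose Y ** matrix_inv R ** Y)
      = (transpose Y ** transpose (matrix_inv Y)) ** C ** (matrix_inv Y ** Y)"
    using assms(4) by (simp add: scaleR_matrix_mult matrix_mul_assoc)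
  then show ?thesis by (simp add: Y Yt)
qed

theorem theorem1:
  fixes Y :: "real ^ 'm ^ 'm" and R C :: "real ^ 'm ^ 'm"
  assumes "rank Y = CARD('m)"
    and "R \<in> spd_matrices" and "C \<in> spd_matrices"
  shows "matnorm_loss R C Y
           \<ge> (real CARD('m))\<^sup>2
             + real CARD('m) * ln (det ((Y ** transpose Y) /\<^sub>R real CARD('m)))
    \<and> (R = (Y ** matrix_inv C ** transpose Y) /\<^sub>R real CARD('m) \<longrightarrow>
         matnorm_loss R C Y
           = (real CARD('m))\<^sup>2
             + real CARD('m) * ln (det ((Y ** transpose Y) /\<^sub>R real CARD('m))))
    \<and> (C = (transpose Y ** matrix_inv R ** Y) /\<^sub>R real CARD('m) \<longrightarrow>
         matnorm_loss R C Y
           = (real CARD('m))\<^sup>2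
             + real CARD('m) * ln (det ((Y ** transpose Y) /\<^sub>R real CARD('m))))
    \<and> (R = (Y ** matrix_inv C ** transpose Y) /\<^sub>R real CARD('m) \<longleftrightarrow>
         C = (transpose Y ** matrix_inv R ** Y) /\<^sub>R real CARD('m))"
proof -
  let ?m = "real CARD('m)"
  let ?S = "(Y ** matrix_inv C ** transpose Y) /\<^sub>R ?m"
  let ?bound = "?m\<^sup>2 + ?m * ln (det ((Y ** transpose Y) /\<^sub>R ?m))"
  have Y: "invertible Y"
    using assms(1) det_eq_0_rank[of Y] by (simp add: invertible_det_nz)
  have Yt: "invertible (transpose Y)" using Y by (simp add: invertible_det_nz)
  note R = invertible_spd_matrices[OF assms(2)] and C = invertible_spd_matrices[OF assms(3)]
  note loss = matnorm_loss_eq[OF Y assms(2,3)]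
  have "trace (matrix_inv R ** ?S) \<ge> ?m + ln (det (matrix_inv R)) + ln (det ?S)"
    by (rule trace_mult_spd_matrices_ge[OF matrix_inv_spd_matrices[OF assms(2)] loss(1)])
  \<comment> \<open>In \<open>loss(2)\<close> the two subtracted logarithms cancel those in the
    trace bound.\<close>
  then have "?m * (?m + ln (det ((Y ** transpose Y) /\<^sub>R ?m))) \<le> matnorm_loss R C Y"
    unfolding loss(2) by (intro mult_left_mono) auto
  then have bound: "matnorm_loss R C Y \<ge> ?bound"
    by (simp add: power2_eq_square algebra_simps)
  \<comment> \<open>Here the trace is that of the identity, and the logarithms of
    \<open>det (matrix_inv R)\<close> and \<open>det R\<close> cancel.\<close>
  have eq: "matnorm_loss R C Y = ?bound" if "R = ?S"
  proof -
    have "ln (det (matrix_inv R)) = - ln (det R)"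
      using det_spd_matrices_pos[OF assms(2)] by (simp add: det_matrix_inv[OF R] ln_inverse)
    then show ?thesis
      unfolding loss(2) that[symmetric]
      by (simp add: matrix_inv_mult[OF R] trace_I power2_eq_square algebra_simps)
  qed
  have iff: "R = ?S \<longleftrightarrow> C = (transpose Y ** matrix_inv R ** Y) /\<^sub>R ?m"
  proof
    show "C = (transpose Y ** matrix_inv R ** Y) /\<^sub>R ?m" if "R = ?S"
      by (rule flip_flop_fixed_point[OF Y R C _ that]) simp
    show "R = ?S" if "C = (transpose Y ** matrix_inv R ** Y) /\<^sub>R ?m"
      \<comment> \<open>The converse is the same computation with rows and columns
        exchanged.\<close>
      using flip_flop_fixed_point[OF Yt C R, of "inverse ?m", unfolded transpose_transpose, OF _ that]
      by simp
  qed
  from bound eq iff show ?thesis by blast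
qed

end
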